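(* Let $k \ge 0$ be an integer, let $G$ be a graph on $n$ vertices, let $d_1 \le d_2 \le \ldots \le d_n$ be its degree sequence, and let $v_1, \ldots, v_n$ be the vertices of $G$ ordered so that $\deg(v_i) = d_i$ for each $i$. Then: (i) $S_k(G) \ge \alpha_k(G)$ and $L_k(G) \ge \omega_k(G)$; (ii) $S_k(G) \ge \frac{n}{\varphi_k(G)}$ and $L_k(G) \ge \frac{n}{\Omega_k(G)}$; (iii) $S_k(G) = \max\{ s \in \{1,\ldots,n\} : d_s \le n - s + k \}$, and $\{v_1, v_2, \ldots, v_{S_k(G)}\}$ is a maximum $k$-small set of $G$; (iv) $L_k(G) = \max\{ t \in \{1,\ldots,n\} : t - k - 1 \le d_{n-t+1} \}$, and $\{v_{n-L_k(G)+1}, v_{n-L_k(G)+2}, \ldots, v_n\}$ is a maximum $k$-large set of $G$.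
   Context: Graphs are finite and simple with nonempty vertex set; $n = |V(G)|$. For an integer $k \ge 0$: a set $A \subseteq V(G)$ is $k$-small if $\deg(v) \le n - |A| + k$ for every $v \in A$; a set $B \subseteq V(G)$ is $k$-large if $\deg(v) \ge |B| - k - 1$ for every $v \in B$. $S_k(G)$ and $L_k(G)$ are the maximum cardinalities of a $k$-small set and of a $k$-large set of $G$, respectively. $\varphi_k(G)$ (resp. $\Omega_k(G)$) is the minimum integer $t$ such that $V(G)$ can be partitioned into $t$ $k$-small (resp. $k$-large) sets. A set $A \subseteq V(G)$ is $k$-independent if $|N(v) \cap A| \le k$ for every $v \in A$; $\alpha_k(G)$ is the maximum cardinality of a $k$-independent set. A set $B \subseteq V(G)$ is a $k$-near clique if $|N(v) \cap B| \ge |B| - k - 1$ for every $v \in B$; $\omega_k(G)$ is the maximum cardinality of a $k$-near clique. *)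

theory Defs
  imports Complex_Main "HOL-Library.Disjoint_Sets" "Graph_Theory.Digraph"
begin

text \<open>
  A finite simple graph is rendered by the locale \<open>graph\<close> of the entry \<open>Graph_Theory\<close>: a finite,
  loop-free, symmetric digraph without parallel arcs. An undirected edge is thus a pair of
  opposite arcs, and the degree of a vertex is its out-degree. That locale allows the graph
  without vertices, so nonemptiness of \<open>verts G\<close> has to be assumed separately.
\<close>

abbreviation degree :: "('a, 'b) pre_digraph \<Rightarrow> 'a \<Rightarrow> nat" where
  "degree G v \<equiv> out_degree G v"

definition neighborhood :: "('a, 'b) pre_digraph \<Rightarrow> 'a \<Rightarrow> 'a set" where
  "neighborhood G v = {u. v \<rightarrow>\<^bsub>G\<^esub> u}"

lemma (in graph) degree_eq_card_neighborhood: "degree G v = card (neighborhood G v)"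
proof -
  have "inj_on (head G) (out_arcs G v)"
    by (auto intro!: inj_onI no_multi_arcs simp: arc_to_ends_def)
  moreover have "head G ` out_arcs G v = neighborhood G v"
    by (auto simp: neighborhood_def arcs_ends_def arc_to_ends_def)
  ultimately show ?thesis
    unfolding out_degree_def by (metis card_image)
qed

text \<open>
  The defining inequalities are stated over the integers, because the differences
  occurring in them may be negative.
\<close>

definition k_small :: "nat \<Rightarrow> ('a, 'b) pre_digraph \<Rightarrow> 'a set \<Rightarrow> bool" where
  "k_small k G A \<longleftrightarrow> A \<subseteq> verts G \<and>
     (\<forall>v\<in>A. int (degree G v) \<le> int (card (verts G)) - int (card A) + int k)"

definition k_large :: "nat \<Rightarrow> ('a, 'b) pre_digraph \<Rightarrow> 'a set \<Rightarrow> bool" where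
  "k_large k G B \<longleftrightarrow> B \<subseteq> verts G \<and>
     (\<forall>v\<in>B. int (degree G v) \<ge> int (card B) - int k - 1)"

definition k_independent :: "nat \<Rightarrow> ('a, 'b) pre_digraph \<Rightarrow> 'a set \<Rightarrow> bool" where
  "k_independent k G A \<longleftrightarrow> A \<subseteq> verts G \<and>
     (\<forall>v\<in>A. card (neighborhood G v \<inter> A) \<le> k)"

definition k_near_clique :: "nat \<Rightarrow> ('a, 'b) pre_digraph \<Rightarrow> 'a set \<Rightarrow> bool" where
  "k_near_clique k G B \<longleftrightarrow> B \<subseteq> verts G \<and>
     (\<forall>v\<in>B. int (card (neighborhood G v \<inter> B)) \<ge> int (card B) - int k - 1)"

definition S_num :: "nat \<Rightarrow> ('a, 'b) pre_digraph \<Rightarrow> nat" where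
  "S_num k G = Max {card A | A. k_small k G A}"

definition L_num :: "nat \<Rightarrow> ('a, 'b) pre_digraph \<Rightarrow> nat" where
  "L_num k G = Max {card B | B. k_large k G B}"

definition \<alpha>_num :: "nat \<Rightarrow> ('a, 'b) pre_digraph \<Rightarrow> nat" where
  "\<alpha>_num k G = Max {card A | A. k_independent k G A}"

definition \<omega>_num :: "nat \<Rightarrow> ('a, 'b) pre_digraph \<Rightarrow> nat" where
  "\<omega>_num k G = Max {card B | B. k_near_clique k G B}"

definition \<phi>_num :: "nat \<Rightarrow> ('a, 'b) pre_digraph \<Rightarrow> nat" where
  "\<phi>_num k G = (LEAST t. \<exists>P. partition_on (verts G) P \<and> card P = t \<and> (\<forall>A\<in>P. k_small k G A))"

definition \<Omega>_num :: "nat \<Rightarrow> ('a, 'b) pre_digraph \<Rightarrow> nat" where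
  "\<Omega>_num k G = (LEAST t. \<exists>P. partition_on (verts G) P \<and> card P = t \<and> (\<forall>B\<in>P. k_large k G B))"

end

theory Submission
  imports Defs
begin

text \<open>
  A vertex of a set \<open>A\<close> has at most \<open>n - card A\<close> neighbours outside \<open>A\<close> and at least as many in
  the whole graph as in \<open>A\<close>, so \<open>k\<close>-independent sets are \<open>k\<close>-small and \<open>k\<close>-near cliques are
  \<open>k\<close>-large. A partition of \<open>n\<close> vertices into \<open>t\<close> classes of size at most \<open>m\<close> forces
  \<open>n \<le> t * m\<close>. Finally, a set of size \<open>s\<close> contains a vertex of index at least \<open>s\<close> and one of
  index at most \<open>n - s + 1\<close> in the degree ordering; hence if some \<open>k\<close>-small (\<open>k\<close>-large) set of
  size \<open>s\<close> exists, the first (last) \<open>s\<close> vertices form one.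
\<close>

section \<open>Counting in families of finite sets and in enumerations\<close>

lemma finite_card_family:
  assumes "finite V" "\<And>A. Q A \<Longrightarrow> A \<subseteq> V"
  shows "finite {card A | A. Q A}"
proof (rule finite_subset)
  show "{card A | A. Q A} \<subseteq> {..card V}"
    using assms by (auto intro: card_mono)
qed simp

text \<open>The premise \<open>P {}\<close> keeps the smaller family of cardinalities nonempty, so
  its \<open>Max\<close> is a genuine maximum.\<close>

lemma Max_card_mono:
  assumes "finite V" "\<And>A. Q A \<Longrightarrow> A \<subseteq> V" "P {}" "\<And>A. P A \<Longrightarrow> Q A"
  shows "Max {card A | A. P A} \<le> Max {card A | A. Q A}"
proof (rule Max_mono)
  show "finite {card A | A. Q A}"
    using assms(1,2) by (rule finite_card_family)
qed (use assms in auto)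

text \<open>Singletons satisfying \<open>Q\<close> provide one admissible partition, so
  \<open>LEAST\<close> is attained; summing the class sizes of an optimal partition then gives the
  bound.\<close>

lemma card_le_Least_partition_mult_Max:
  assumes "finite V" "\<And>A. Q A \<Longrightarrow> A \<subseteq> V" "\<And>x. x \<in> V \<Longrightarrow> Q {x}"
  shows "card V \<le> (LEAST t. \<exists>P. partition_on V P \<and> card P = t \<and> (\<forall>A\<in>P. Q A))
           * Max {card A | A. Q A}"
proof -
  let ?R = "\<lambda>t. \<exists>P. partition_on V P \<and> card P = t \<and> (\<forall>A\<in>P. Q A)"
  have "partition_on V ((\<lambda>x. {x}) ` V)"
    by (auto simp: partition_on_def disjoint_def)
  then have "?R (card ((\<lambda>x. {x}) ` V))"
    using assms(3) by blast
  then have "?R (LEAST t. ?R t)"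
    by (rule LeastI)
  then obtain P where P: "partition_on V P" "card P = (LEAST t. ?R t)" "\<forall>A\<in>P. Q A"
    by blast
  have "card V = card (\<Union>P)"
    using P(1) by (simp add: partition_on_def)
  also have "\<dots> \<le> (\<Sum>A\<in>P. card A)"
    by (rule card_Union_le_sum_card)
  also have "\<dots> \<le> of_nat (card P) * Max {card A | A. Q A}"
    using P(3) finite_card_family[OF assms(1,2)] by (intro sum_bounded_above Max_ge) auto
  finally show ?thesis
    using P(2) by simp
qed

lemma real_divide_le:
  fixes m n t :: nat
  assumes "n \<le> t * m"
  shows "real n / real t \<le> real m"
\<comment> \<open>For \<open>t = 0\<close> the quotient is 0 by the convention on division by
  zero.\<close>
proof (cases "t = 0")
  case False
  then show ?thesis
    using assms by (simp add: divide_le_eq mult.commute flip: of_nat_mult)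
qed simp

text \<open>Common frame for both degree formulas: \<open>R\<close> collects the admissible sizes
  and \<open>F s\<close> is the canonical set of size \<open>s\<close>. The empty set is treated
  apart because \<open>R\<close> will consist of positive indices.\<close>

lemma Max_card_eq_index:
  assumes "finite R" "R \<noteq> {}"
    and "\<And>s. s \<in> R \<Longrightarrow> Q (F s) \<and> card (F s) = s"
    and "\<And>A. Q A \<Longrightarrow> A \<noteq> {} \<Longrightarrow> card A \<in> R"
  shows "Max {card A | A. Q A} = Max R \<and> is_arg_max card Q (F (Max R))"
proof -
  have F: "Q (F (Max R))" "card (F (Max R)) = Max R"
    using assms(1-3) by auto
  have le: "card A \<le> Max R" if "Q A" for A
    using assms(1,4) that by (cases "A = {}") auto
  have "Max {card A | A. Q A} = Max R"
  proof (rule Max_eqI)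
    show "finite {card A | A. Q A}"
      using le by (auto intro: finite_subset[of _ "{..Max R}"])
    show "Max R \<in> {card A | A. Q A}"
      using F(1) F(2)[symmetric] by blast
  qed (use le in auto)
  moreover have "is_arg_max card Q (F (Max R))"
    using F le by (simp add: is_arg_max_linorder)
  ultimately show ?thesis ..
qed

text \<open>Pigeonhole: the indices below \<open>card A\<close> are one too few to enumerate
  \<open>A\<close>.\<close>

lemma ex_index_ge_card:
  assumes "A \<noteq> {}" "A \<subseteq> v ` {1..n::nat}"
  shows "card A \<in> {1..n}" "\<exists>i\<in>{card A..n}. v i \<in> A"
proof -
  have fin: "finite A"
    using assms(2) by (rule finite_subset) simp
  have "card A \<le> card {1..n}"
    using assms(2) by (metis card_image_le card_mono finite_atLeastAtMost finite_imageI le_trans)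
  then show A: "card A \<in> {1..n}"
    using fin assms(1) by (simp add: Suc_le_eq card_gt_0_iff)
  show "\<exists>i\<in>{card A..n}. v i \<in> A"
  proof (rule ccontr)
    assume "\<not> ?thesis"
    then have "A \<subseteq> v ` {1..<card A}"
      using assms(2) by fastforce
    then have "card A \<le> card {1..<card A}"
      by (rule surj_card_le[rotated]) simp
    with A show False by simp linarith
  qed
qed

lemma ex_index_le_card:
  assumes "A \<noteq> {}" "A \<subseteq> v ` {1..n::nat}"
  shows "\<exists>i\<in>{1..n - card A + 1}. v i \<in> A"
proof (rule ccontr)
  assume "\<not> ?thesis"
  then have "A \<subseteq> v ` {n - card A + 2..n}"
    using assms(2) by fastforce
  then have "card A \<le> card {n - card A + 2..n}"
    by (rule surj_card_le[rotated]) simp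
  \<comment> \<open>As \<open>1 \<le> card A \<le> n\<close>, the interval has exactly
    \<open>card A - 1\<close> elements.\<close>
  with ex_index_ge_card(1)[OF assms] show False by simp linarith
qed

section \<open>Small and large sets in a graph\<close>

context graph
begin

lemma neighborhood_subset_verts: "neighborhood G v \<subseteq> verts G"
  by (auto simp: neighborhood_def)

lemma not_in_own_neighborhood: "v \<notin> neighborhood G v"
  by (auto simp: neighborhood_def dest: adj_not_same)

lemma finite_neighborhood: "finite (neighborhood G v)"
  using neighborhood_subset_verts finite_verts by (rule finite_subset)

lemma k_independent_imp_k_small:
  assumes "k_independent k G A"
  shows "k_small k G A"
proof -
  have A: "A \<subseteq> verts G" "finite A"
    using assms finite_subset[OF _ finite_verts] by (auto simp: k_independent_def)
  have "int (degree G v) \<le> int (card (verts G)) - int (card A) + int k" if "v \<in> A" for v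
  proof -
    have "degree G v = card (neighborhood G v \<inter> A) + card (neighborhood G v - A)"
      unfolding degree_eq_card_neighborhood
      using finite_neighborhood by (simp add: card_Int_Diff)
    moreover have "card (neighborhood G v - A) \<le> card (verts G - A)"
      using neighborhood_subset_verts by (intro card_mono) auto
    moreover have "card (verts G - A) = card (verts G) - card A"
      using A by (simp add: card_Diff_subset)
    \<comment> \<open>With this, the truncated difference above agrees with the integer difference
      in the claim.\<close>
    moreover have "card A \<le> card (verts G)"
      using A by (intro card_mono) auto
    moreover have "card (neighborhood G v \<inter> A) \<le> k"
      using assms that by (simp add: k_independent_def)
    ultimately show ?thesis by linarith
  qed
  with A show ?thesis by (simp add: k_small_def)
qed

lemma k_near_clique_imp_k_large:
  assumes "k_near_clique k G B"
  shows "k_large k G B"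
proof -
  have "card (neighborhood G v \<inter> B) \<le> degree G v" for v
    unfolding degree_eq_card_neighborhood
    using finite_neighborhood by (intro card_mono) auto
  then show ?thesis
    using assms unfolding k_near_clique_def k_large_def
    by (meson of_nat_mono order_trans)
qed

text \<open>Without loops a vertex has degree at most \<open>card (verts G) - 1\<close>, which is
  the bound for a one-element set already at \<open>k = 0\<close>.\<close>

lemma k_small_singleton:
  assumes "v \<in> verts G"
  shows "k_small k G {v}"
proof -
  have "neighborhood G v \<subset> verts G"
    using assms neighborhood_subset_verts not_in_own_neighborhood by blast
  then have "degree G v < card (verts G)"
    unfolding degree_eq_card_neighborhood by (intro psubset_card_mono) auto
  with assms show ?thesis by (simp add: k_small_def)
qed

lemma k_large_singleton: "v \<in> verts G \<Longrightarrow> k_large k G {v}"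
  by (simp add: k_large_def)

end

section \<open>Inequalities between the parameters and formulas from the degree sequence\<close>

theorem theorem2p2:
  fixes k n :: nat
    and G :: "('a, 'b) pre_digraph"
    and d :: "nat \<Rightarrow> nat"
    and v :: "nat \<Rightarrow> 'a"
  assumes "graph G"
    and "verts G \<noteq> {}"
    and "n = card (verts G)"
    and "bij_betw v {1..n} (verts G)"
    and "\<forall>i\<in>{1..n}. degree G (v i) = d i"
    and "mono_on {1..n} d"
  shows "(S_num k G \<ge> \<alpha>_num k G \<and> L_num k G \<ge> \<omega>_num k G) \<and>
    (real (S_num k G) \<ge> real n / real (\<phi>_num k G) \<and>
      real (L_num k G) \<ge> real n / real (\<Omega>_num k G)) \<and>
    (S_num k G = Max {s \<in> {1..n}. int (d s) \<le> int n - int s + int k} \<and>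
      is_arg_max card (k_small k G) (v ` {1..S_num k G})) \<and>
    (L_num k G = Max {t \<in> {1..n}. int t - int k - 1 \<le> int (d (n - t + 1))} \<and>
      is_arg_max card (k_large k G) (v ` {n - L_num k G + 1..n}))"
proof -
  interpret graph G by fact
  have small_sub: "A \<subseteq> verts G" if "k_small k G A" for A
    using that by (simp add: k_small_def)
  have large_sub: "A \<subseteq> verts G" if "k_large k G A" for A
    using that by (simp add: k_large_def)
  have img: "v ` {1..n} = verts G" and inj: "inj_on v {1..n}"
    using assms(4) by (auto simp: bij_betw_def)
  have n: "n \<ge> 1"
    using assms(2,3) by (simp add: Suc_le_eq card_gt_0_iff)
  have deg: "degree G (v i) = d i" if "i \<in> {1..n}" for i
    using assms(5) that by blast
  have d_mono: "d i \<le> d j" if "1 \<le> i" "i \<le> j" "j \<le> n" for i j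
    using assms(6) that by (auto intro: mono_onD)
  have indep: "S_num k G \<ge> \<alpha>_num k G"
    unfolding S_num_def \<alpha>_num_def using finite_verts small_sub
    by (rule Max_card_mono) (auto simp: k_independent_imp_k_small, simp add: k_independent_def)
  have clique: "L_num k G \<ge> \<omega>_num k G"
    unfolding L_num_def \<omega>_num_def using finite_verts large_sub
    by (rule Max_card_mono) (auto simp: k_near_clique_imp_k_large, simp add: k_near_clique_def)
  have phi: "real (S_num k G) \<ge> real n / real (\<phi>_num k G)"
    unfolding S_num_def \<phi>_num_def assms(3)
    by (intro real_divide_le card_le_Least_partition_mult_Max finite_verts small_sub
        k_small_singleton)
  have Omega: "real (L_num k G) \<ge> real n / real (\<Omega>_num k G)"
    unfolding L_num_def \<Omega>_num_def assms(3)
    by (intro real_divide_le card_le_Least_partition_mult_Max finite_verts large_sub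
        k_large_singleton)
  let ?RS = "{s \<in> {1..n}. int (d s) \<le> int n - int s + int k}"
  have S: "Max {card A | A. k_small k G A} = Max ?RS \<and>
      is_arg_max card (k_small k G) (v ` {1..Max ?RS})"
  proof (rule Max_card_eq_index)
    have S_mem: "card A \<in> ?RS" if "k_small k G A" "A \<noteq> {}" for A
    proof -
      have sub: "A \<subseteq> v ` {1..n}"
        using that img by (simp add: k_small_def)
      note card = ex_index_ge_card(1)[OF that(2) sub]
      note index = ex_index_ge_card(2)[OF that(2) sub]
      obtain i where i: "i \<in> {card A..n}" "v i \<in> A"
        using index by blast
      \<comment> \<open>The vertex \<open>v i\<close> of \<open>A\<close> has index at least
        \<open>card A\<close>, so the bound on its degree passes down to
        \<open>d (card A)\<close>.\<close>
      have "d (card A) \<le> d i"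
        using card i by (intro d_mono) auto
      moreover have "int (d i) \<le> int n - int (card A) + int k"
        using that(1) i card deg[of i] by (auto simp: k_small_def assms(3))
      ultimately show ?thesis using card by simp
    qed
    then show "\<And>A. k_small k G A \<Longrightarrow> A \<noteq> {} \<Longrightarrow> card A \<in> ?RS" .
    \<comment> \<open>A single vertex shows that size 1 is admissible.\<close>
    obtain x where "x \<in> verts G" using assms(2) by blast
    then show "?RS \<noteq> {}"
      using S_mem[OF k_small_singleton] by blast
    show "k_small k G (v ` {1..s}) \<and> card (v ` {1..s}) = s" if "s \<in> ?RS" for s
    proof
      have sub: "{1..s} \<subseteq> {1..n}" using that by auto
      show card: "card (v ` {1..s}) = s"
        using inj_on_subset[OF inj sub] by (simp add: card_image)
      have "int (degree G (v i)) \<le> int n - int s + int k" if i: "i \<in> {1..s}" for i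
      proof -
        \<comment> \<open>\<open>d s\<close> is the largest degree among the first \<open>s\<close>
          vertices, so bounding it suffices.\<close>
        have "d i \<le> d s"
          using i \<open>s \<in> ?RS\<close> by (intro d_mono) auto
        with i sub \<open>s \<in> ?RS\<close> show ?thesis by (auto simp: deg)
      qed
      moreover have "v ` {1..s} \<subseteq> verts G"
        using sub img by blast
      ultimately show "k_small k G (v ` {1..s})"
        unfolding k_small_def card using assms(3) by blast
    qed
  qed simp
  let ?RL = "{t \<in> {1..n}. int t - int k - 1 \<le> int (d (n - t + 1))}"
  have L: "Max {card A | A. k_large k G A} = Max ?RL \<and>
      is_arg_max card (k_large k G) (v ` {n - Max ?RL + 1..n})"
  proof (rule Max_card_eq_index)
    have L_mem: "card A \<in> ?RL" if "k_large k G A" "A \<noteq> {}" for A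
    proof -
      have sub: "A \<subseteq> v ` {1..n}"
        using that img by (simp add: k_large_def)
      note card = ex_index_ge_card(1)[OF that(2) sub]
      note index = ex_index_le_card[OF that(2) sub]
      obtain i where i: "i \<in> {1..n - card A + 1}" "v i \<in> A"
        using index by blast
      \<comment> \<open>Dually, the index of \<open>v i\<close> is at most
        \<open>n - card A + 1\<close>, so the lower bound on its degree passes up.\<close>
      have "d i \<le> d (n - card A + 1)"
        using card i by (intro d_mono) auto
      moreover have "int (card A) - int k - 1 \<le> int (d i)"
        using that(1) i card deg[of i] by (auto simp: k_large_def)
      ultimately show ?thesis using card by simp
    qed
    then show "\<And>A. k_large k G A \<Longrightarrow> A \<noteq> {} \<Longrightarrow> card A \<in> ?RL" .
    obtain x where "x \<in> verts G" using assms(2) by blast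
    then show "?RL \<noteq> {}"
      using L_mem[OF k_large_singleton] by blast
    show "k_large k G (v ` {n - t + 1..n}) \<and> card (v ` {n - t + 1..n}) = t" if "t \<in> ?RL" for t
    proof
      have sub: "{n - t + 1..n} \<subseteq> {1..n}" by auto
      \<comment> \<open>Since \<open>t \<le> n\<close>, the truncated difference is exact and the
        interval has \<open>t\<close> indices.\<close>
      show card: "card (v ` {n - t + 1..n}) = t"
        using inj_on_subset[OF inj sub] that by (simp add: card_image)
      have "int (degree G (v i)) \<ge> int t - int k - 1" if i: "i \<in> {n - t + 1..n}" for i
      proof -
        \<comment> \<open>\<open>d (n - t + 1)\<close> is the smallest degree among the last
          \<open>t\<close> vertices.\<close>
        have "d (n - t + 1) \<le> d i"
          using i by (intro d_mono) auto
        with i sub \<open>t \<in> ?RL\<close> show ?thesis by (auto simp: deg)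
      qed
      moreover have "v ` {n - t + 1..n} \<subseteq> verts G"
        using sub img by blast
      ultimately show "k_large k G (v ` {n - t + 1..n})"
        unfolding k_large_def card by blast
    qed
  qed simp
  show ?thesis
    using indep clique phi Omega S L unfolding S_num_def L_num_def by simp
qed

end
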